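(* Let $\mathcal{Q}\colon\mathbb{R}^q\times\mathbb{R}^q\to\mathbb{R}$, $\Theta\subset\mathbb{R}^q$, the point-to-set map $\mathcal{M}$ and the sequence $(\theta_n)_{n\in\mathbb{N}}$ in $\Theta$ with $\theta_{n+1}\in\mathcal{M}(\theta_n)$ be as in the context, and let $\theta_\star\in\Theta$. Assume: (1) $\Theta$ is convex; (2) $(\theta_n)_{n\in\mathbb{N}}$ converges to $\theta_\star$; (3) there exists a neighborhood of $(\theta_\star,\theta_\star)$ on which $\mathcal{Q}$ is continuous and $\partial_2\mathcal{Q}$ is well-defined and $C^1$-differentiable; (4) the matrix $\mathcal{B}_\star$ is symmetric and for all $v\in\mathsf{V}\setminus\{0\}$, $v^\top\mathcal{A}_\star v>|v^\top\mathcal{B}_\star v|$. Assume moreover that $\theta_\star\in\mathrm{ri}(\Theta)$ and that the sequence $(\theta_n)_{n\in\mathbb{N}}$ is not eventually equal to $\theta_\star$. Then $\check\rho_\star\in[0,1)$ and $$\log\check\rho_\star\le\liminf_{n\to\infty}\frac1n\log\|\theta_n-\theta_\star\|_2 .$$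
   Context: Let $q\ge 1$, $\mathcal{Q}\colon\mathbb{R}^q\times\mathbb{R}^q\to\mathbb{R}$, $(\theta,\theta')\mapsto\mathcal{Q}_\theta(\theta')$, and $\Theta\subset\mathbb{R}^q$. For $\theta\in\Theta$ let $\mathcal{M}(\theta):=\operatorname{argmin}_{\theta'\in\Theta}\mathcal{Q}_\theta(\theta')$ (a subset of $\Theta$), assumed nonempty for every $\theta\in\Theta$. $(\theta_n)_{n\in\mathbb{N}}$ is a sequence in $\Theta$ with $\theta_{n+1}\in\mathcal{M}(\theta_n)$ for all $n$. $\partial_2\mathcal{Q}$ is the gradient with respect to the second argument $\theta'$; $\partial_{22}\mathcal{Q}$ and $\partial_{12}\mathcal{Q}$ are the $q\times q$ matrices of derivatives of $\partial_2\mathcal{Q}$ with respect to the second and the first argument respectively. $\mathcal{A}_\star:=\partial_{22}\mathcal{Q}_{\theta_\star}(\theta_\star)$, $\mathcal{B}_\star:=-\partial_{12}\mathcal{Q}_{\theta_\star}(\theta_\star)$. $\mathsf{V}:=\mathrm{span}\{\theta-\theta':\theta,\theta'\in\Theta\}$. $$\check\rho_\star:=\inf_{v\in\mathsf{V}\setminus\{0\}}\frac{|v^\top\mathcal{B}_\star v|}{v^\top\mathcal{A}_\star v}.$$ $\mathrm{ri}(\Theta)$ is the relative interior of $\Theta$, i.e. its interior within its affine hull. Convention: $\log 0=-\infty$. $\|\cdot\|_2$ is the Euclidean norm. *)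

theory Defs
  imports "HOL-Analysis.Analysis"
begin

definition argmin_map :: "('a \<Rightarrow> 'a \<Rightarrow> real) \<Rightarrow> 'a set \<Rightarrow> 'a \<Rightarrow> 'a set" where
  "argmin_map Q \<Theta> \<theta> = {\<theta>'. is_arg_min (Q \<theta>) (\<lambda>x. x \<in> \<Theta>) \<theta>'}"

(* Meaningful only where the gradient exists, i.e. where some D satisfies GDERIV (Q \<theta>) \<theta>' :> D. *)
definition grad2 :: "('a::euclidean_space \<Rightarrow> 'a \<Rightarrow> real) \<Rightarrow> 'a \<Rightarrow> 'a \<Rightarrow> 'a" where
  "grad2 Q \<theta> \<theta>' = (THE D. GDERIV (Q \<theta>) \<theta>' :> D)"

definition hess22 ::
    "(real^'q \<Rightarrow> real^'q \<Rightarrow> real) \<Rightarrow> real^'q \<Rightarrow> real^'q \<Rightarrow> real^'q^'q" where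
  "hess22 Q \<theta> \<theta>' = jacobian (\<lambda>y. grad2 Q \<theta> y) (at \<theta>')"

definition hess12 ::
    "(real^'q \<Rightarrow> real^'q \<Rightarrow> real) \<Rightarrow> real^'q \<Rightarrow> real^'q \<Rightarrow> real^'q^'q" where
  "hess12 Q \<theta> \<theta>' = jacobian (\<lambda>x. grad2 Q x \<theta>') (at \<theta>)"

(* Intended for open U. *)
definition C1_on :: "('a::real_normed_vector \<Rightarrow> 'b::real_normed_vector) \<Rightarrow> 'a set \<Rightarrow> bool" where
  "C1_on f U \<longleftrightarrow>
     (\<exists>f' :: 'a \<Rightarrow> 'a \<Rightarrow>\<^sub>L 'b.
        (\<forall>x\<in>U. (f has_derivative blinfun_apply (f' x)) (at x)) \<and> continuous_on U f')"

definition diff_span :: "'a::real_vector set \<Rightarrow> 'a set" where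
  "diff_span \<Theta> = span {\<theta> - \<theta>' | \<theta> \<theta>'. \<theta> \<in> \<Theta> \<and> \<theta>' \<in> \<Theta>}"

(* A real infimum, hence meaningful only if V contains a nonzero vector and the
   quotients are bounded below. *)
definition rho_check :: "real^'q^'q \<Rightarrow> real^'q^'q \<Rightarrow> (real^'q) set \<Rightarrow> real" where
  "rho_check A B V = (INF v\<in>V - {0}. \<bar>v \<bullet> (B *v v)\<bar> / (v \<bullet> (A *v v)))"

(* Logarithm on the nonnegative reals with log 0 = -\<infinity>. *)
definition elog :: "real \<Rightarrow> ereal" where
  "elog x = (if x \<le> 0 then -\<infinity> else ereal (ln x))"

end

theory Submission
  imports Defs
begin

text \<open>For large \<open>n\<close> the iterates lie in the relative interior, so \<open>\<partial>\<^sub>2 Q\<close> at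
  \<open>(\<theta> n, \<theta> (Suc n))\<close>, and in the limit at \<open>(\<theta>s, \<theta>s)\<close>, is orthogonal to \<open>V\<close>. With
  \<open>d n = \<theta> n - \<theta>s\<close>, differentiability gives \<open>A d (Suc n) = B d n + o(norm (d n))\<close> modulo the
  orthogonal complement of \<open>V\<close>. The Hessian \<open>A\<close> is symmetric, hence an inner product on \<open>V\<close>, and
  pairing with \<open>d n\<close> yields \<open>|d (Suc n)|\<^sub>A |d n|\<^sub>A \<ge> |d n \<bullet> B d n| - o(|d n|\<^sub>A\<^sup>2) \<ge>
  (\<rho> - o(1)) |d n|\<^sub>A\<^sup>2\<close>, so the \<open>A\<close>-norm of \<open>d n\<close> decays no faster than any geometric sequence of
  ratio below \<open>\<rho>\<close>.\<close>

section \<open>Gradients along lines and the symmetry of the Hessian\<close>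

lemma GDERIV_along_line:
  assumes "GDERIV f (a + t *\<^sub>R u) :> D"
  shows "((\<lambda>s. f (a + s *\<^sub>R u)) has_real_derivative D \<bullet> u) (at t)"
proof -
  have "((\<lambda>s. a + s *\<^sub>R u) has_derivative (\<lambda>h. h *\<^sub>R u)) (at t)"
    by (auto intro!: derivative_eq_intros)
  from has_derivative_compose[OF this] assms
  have "((\<lambda>s. f (a + s *\<^sub>R u)) has_derivative (\<lambda>h. (h *\<^sub>R u) \<bullet> D)) (at t)"
    unfolding gderiv_def by blast
  then show ?thesis
    unfolding has_field_derivative_def by (simp add: inner_commute mult_commute_abs)
qed

lemma GDERIV_local_min_orthogonal:
  assumes "GDERIV f y :> D" "\<delta> > 0"
    and min: "\<And>t. \<bar>t\<bar> < \<delta> \<Longrightarrow> f y \<le> f (y + t *\<^sub>R v)"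
  shows "D \<bullet> v = 0"
proof (rule DERIV_local_min[OF _ \<open>\<delta> > 0\<close>])
  show "((\<lambda>s. f (y + s *\<^sub>R v)) has_real_derivative D \<bullet> v) (at 0)"
    by (rule GDERIV_along_line) (use assms in simp)
  show "\<forall>t. \<bar>0 - t\<bar> < \<delta> \<longrightarrow> f (y + 0 *\<^sub>R v) \<le> f (y + t *\<^sub>R v)"
    using min by simp
qed

text \<open>The second difference is the change along \<open>u\<close> of the increment along
  \<open>v\<close>, so one mean value argument in direction \<open>u\<close> reduces it to a
  first-order expansion of \<open>G\<close> at \<open>a\<close>. The two remainders, of size at most
  \<epsilon> times t (|u| + |v|) and t |u|, add up to the factor
  \<open>2 * norm u + norm v\<close>.\<close>

lemma gradient_second_difference:
  fixes f :: "'a::real_inner \<Rightarrow> real"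
  assumes "\<epsilon> > 0"
    and grad: "\<forall>\<^sub>F y in nhds a. GDERIV f y :> G y"
    and L: "(G has_derivative L) (at a)"
  shows "\<forall>\<^sub>F t in at_right 0.
    \<bar>(f (a + t *\<^sub>R u + t *\<^sub>R v) - f (a + t *\<^sub>R u) - f (a + t *\<^sub>R v) + f a) / t\<^sup>2 - u \<bullet> L v\<bar>
      \<le> \<epsilon> * (norm u * (2 * norm u + norm v))"
proof -
  interpret L: bounded_linear L using L by (rule has_derivative_bounded_linear)
  obtain e where e: "e > 0" "\<And>y. norm (y - a) < e \<Longrightarrow> GDERIV f y :> G y"
    using grad unfolding eventually_nhds_metric dist_norm by blast
  obtain d where d: "d > 0"
    "\<And>y. norm (y - a) < d \<Longrightarrow> norm (G y - G a - L (y - a)) \<le> \<epsilon> * norm (y - a)"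
    using L \<open>\<epsilon> > 0\<close> unfolding has_derivative_at_alt by blast
  \<comment> \<open>For t below \<open>b\<close>, every point a + s u + c v with s and c in [0, t]
    lies where \<open>f\<close> has gradient \<open>G\<close> and the expansion of \<open>G\<close>
    is accurate to \<epsilon>. The summand 1 keeps the denominator positive.\<close>
  define b where "b = min d e / (norm u + norm v + 1)"
  have pos: "norm u + norm v + 1 > 0" by (simp add: add_nonneg_pos)
  have "b > 0" unfolding b_def using d(1) e(1) pos by simp
  have "\<bar>(f (a + t *\<^sub>R u + t *\<^sub>R v) - f (a + t *\<^sub>R u) - f (a + t *\<^sub>R v) + f a) / t\<^sup>2 - u \<bullet> L v\<bar>
      \<le> \<epsilon> * (norm u * (2 * norm u + norm v))" if t: "0 < t" "t < b" for t
  proof -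
    have tb: "t * (norm u + norm v + 1) < min d e"
      using t(2) pos unfolding b_def by (simp add: pos_less_divide_eq)
    have near: "norm (s *\<^sub>R u + c *\<^sub>R v) < min d e \<and> norm (s *\<^sub>R u + c *\<^sub>R v) \<le> s * norm u + c * norm v"
      if "0 \<le> s" "s \<le> t" "0 \<le> c" "c \<le> t" for s c
    proof -
      have 1: "norm (s *\<^sub>R u + c *\<^sub>R v) \<le> s * norm u + c * norm v"
        using norm_triangle_ineq[of "s *\<^sub>R u" "c *\<^sub>R v"] that by simp
      have "s * norm u \<le> t * norm u" "c * norm v \<le> t * norm v"
        using that by (auto intro: mult_right_mono)
      then show ?thesis using 1 tb t by (simp add: algebra_simps)
    qed
    define \<psi> where "\<psi> s = f (a + t *\<^sub>R v + s *\<^sub>R u) - f (a + s *\<^sub>R u)" for s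
    have "(\<psi> has_real_derivative G (a + t *\<^sub>R v + s *\<^sub>R u) \<bullet> u - G (a + s *\<^sub>R u) \<bullet> u) (at s)"
      if "0 \<le> s" "s \<le> t" for s
      unfolding \<psi>_def
    proof (intro DERIV_diff GDERIV_along_line e(2))
      show "norm (a + t *\<^sub>R v + s *\<^sub>R u - a) < e"
        using near[of s t] that t by (simp add: algebra_simps)
      show "norm (a + s *\<^sub>R u - a) < e"
        using near[of s 0] that t by (simp add: algebra_simps)
    qed
    from MVT2[OF t(1) this] obtain z where z: "0 < z" "z < t"
      "\<psi> t - \<psi> 0 = t * (G (a + t *\<^sub>R v + z *\<^sub>R u) \<bullet> u - G (a + z *\<^sub>R u) \<bullet> u)"
      by auto
    define p where "p = G (a + (z *\<^sub>R u + t *\<^sub>R v)) - G a - L (z *\<^sub>R u + t *\<^sub>R v)"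
    define q where "q = G (a + z *\<^sub>R u) - G a - L (z *\<^sub>R u)"
    have "norm p \<le> \<epsilon> * norm (z *\<^sub>R u + t *\<^sub>R v)"
      unfolding p_def using d(2)[of "a + (z *\<^sub>R u + t *\<^sub>R v)"] near[of z t] z t by simp
    also have "\<dots> \<le> \<epsilon> * (t * norm u + t * norm v)"
    proof (intro mult_left_mono)
      have "z * norm u \<le> t * norm u" using z by (intro mult_right_mono) auto
      then show "norm (z *\<^sub>R u + t *\<^sub>R v) \<le> t * norm u + t * norm v"
        using near[of z t] z t by linarith
    qed (use \<open>\<epsilon> > 0\<close> in auto)
    finally have p: "norm p \<le> \<epsilon> * (t * norm u + t * norm v)" .
    have "norm q \<le> \<epsilon> * norm (z *\<^sub>R u)"
      unfolding q_def using d(2)[of "a + z *\<^sub>R u"] near[of z 0] z t by simp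
    also have "\<dots> \<le> \<epsilon> * (t * norm u)"
      using z \<open>\<epsilon> > 0\<close> by (intro mult_left_mono) (auto intro: mult_right_mono)
    finally have q: "norm q \<le> \<epsilon> * (t * norm u)" .
    \<comment> \<open>The terms L (z u) of the two expansions cancel, so the unknown mean value
      point \<open>z\<close> survives only in the remainders \<open>p\<close> and
      \<open>q\<close>.\<close>
    have eq: "\<psi> t - \<psi> 0 = t * (t * (u \<bullet> L v) + u \<bullet> (p - q))"
      unfolding z(3) p_def q_def L.add L.scaleR
      by (simp add: inner_add_right inner_diff_right inner_commute algebra_simps)
    have "(\<psi> t - \<psi> 0) / t\<^sup>2 - u \<bullet> L v = (u \<bullet> (p - q)) / t"
      unfolding eq using t by (simp add: field_simps power2_eq_square)
    moreover have "\<bar>u \<bullet> (p - q)\<bar> \<le> norm u * (\<epsilon> * (t * norm u + t * norm v) + \<epsilon> * (t * norm u))"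
      using Cauchy_Schwarz_ineq2[of u "p - q"] norm_triangle_ineq4[of p q] p q
      by (meson add_mono mult_left_mono norm_ge_zero order_trans)
    then have "\<bar>u \<bullet> (p - q)\<bar> / t \<le> \<epsilon> * (norm u * (2 * norm u + norm v))"
      using t by (simp add: field_simps)
    ultimately show ?thesis
      using t by (simp add: \<psi>_def algebra_simps)
  qed
  with \<open>b > 0\<close> show ?thesis
    unfolding eventually_at_right_field by (intro exI[of _ b]) auto
qed

text \<open>Interchanging \<open>u\<close> and \<open>v\<close> does not change the second
  difference, so both sides are limits of the same quotient.\<close>

lemma gradient_derivative_symmetric:
  fixes f :: "'a::real_inner \<Rightarrow> real"
  assumes grad: "\<forall>\<^sub>F y in nhds a. GDERIV f y :> G y"
    and L: "(G has_derivative L) (at a)"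
  shows "u \<bullet> L v = v \<bullet> L u"
proof -
  define c where "c = norm u * (2 * norm u + norm v) + norm v * (2 * norm v + norm u)"
  have "c \<ge> 0" unfolding c_def by simp
  have "\<bar>u \<bullet> L v - v \<bullet> L u\<bar> \<le> 0 + e" if "e > 0" for e
  proof -
    define \<epsilon> where "\<epsilon> = e / (c + 1)"
    have "\<epsilon> > 0" using that \<open>c \<ge> 0\<close> by (simp add: \<epsilon>_def)
    have "\<forall>\<^sub>F t in at_right (0::real). \<bar>u \<bullet> L v - v \<bullet> L u\<bar> \<le> \<epsilon> * c"
      using gradient_second_difference[OF \<open>\<epsilon> > 0\<close> grad L, of u v]
        gradient_second_difference[OF \<open>\<epsilon> > 0\<close> grad L, of v u]
    proof eventually_elim
      case (elim t)
      have "a + t *\<^sub>R v + t *\<^sub>R u = a + t *\<^sub>R u + t *\<^sub>R v" by (simp add: add_ac)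
      then have "f (a + t *\<^sub>R v + t *\<^sub>R u) - f (a + t *\<^sub>R v) - f (a + t *\<^sub>R u) + f a
        = f (a + t *\<^sub>R u + t *\<^sub>R v) - f (a + t *\<^sub>R u) - f (a + t *\<^sub>R v) + f a" by (simp only:)
      from elim(2)[unfolded this] elim(1) show ?case
        unfolding c_def distrib_left[of \<epsilon>] by linarith
    qed
    \<comment> \<open>The inequality no longer involves \<open>t\<close>, and
      \<open>at_right 0\<close> is a nontrivial filter, so it holds outright.\<close>
    then have "\<bar>u \<bullet> L v - v \<bullet> L u\<bar> \<le> \<epsilon> * c"
      by (simp add: eventually_const)
    also have "\<dots> \<le> e"
      using that \<open>c \<ge> 0\<close> unfolding \<epsilon>_def by (simp add: field_simps)
    finally show ?thesis by simp
  qed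
  then have "\<bar>u \<bullet> L v - v \<bullet> L u\<bar> \<le> 0" by (rule field_le_epsilon)
  then show ?thesis by simp
qed

section \<open>Forms that are positive definite on a subspace\<close>

lemma positive_form_Cauchy_Schwarz:
  fixes a :: "'a::real_inner \<Rightarrow> 'a"
  assumes "linear a" "subspace V" "u \<in> V" "v \<in> V"
    and pos: "\<And>w. w \<in> V - {0} \<Longrightarrow> 0 < w \<bullet> a w"
    and sym: "u \<bullet> a v = v \<bullet> a u"
  shows "(u \<bullet> a v)\<^sup>2 \<le> (u \<bullet> a u) * (v \<bullet> a v)"
proof (cases "v = 0")
  case True
  then show ?thesis using linear_0[OF \<open>linear a\<close>] by simp
next
  case False
  have nonneg: "0 \<le> w \<bullet> a w" if "w \<in> V" for w
    using pos[of w] that by (cases "w = 0") auto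
  \<comment> \<open>This is \<open>v \<bullet> a v\<close> times the component of \<open>u\<close>
    orthogonal to \<open>v\<close> with respect to the form. Nonnegativity at \<open>w\<close> is
    the claim multiplied by \<open>v \<bullet> a v\<close>.\<close>
  define w where "w = (v \<bullet> a v) *\<^sub>R u - (u \<bullet> a v) *\<^sub>R v"
  have "w \<in> V" unfolding w_def using assms by (intro subspace_diff subspace_scale)
  have aw: "a w = (v \<bullet> a v) *\<^sub>R a u - (u \<bullet> a v) *\<^sub>R a v"
    unfolding w_def using \<open>linear a\<close> by (simp add: linear_diff linear_scale)
  have "w \<bullet> a w = (v \<bullet> a v) * ((u \<bullet> a u) * (v \<bullet> a v) - (u \<bullet> a v)\<^sup>2)"
    unfolding aw using sym unfolding w_def
    by (simp add: inner_diff_left inner_diff_right algebra_simps power2_eq_square)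
  then have "0 \<le> (v \<bullet> a v) * ((u \<bullet> a u) * (v \<bullet> a v) - (u \<bullet> a v)\<^sup>2)"
    using nonneg[OF \<open>w \<in> V\<close>] by simp
  then show ?thesis
    using pos[of v] False \<open>v \<in> V\<close> by (simp add: zero_le_mult_iff)
qed

text \<open>By homogeneity it is enough to look at the unit sphere of \<open>V\<close>; it is
  compact, so if nonempty it carries a positive minimum of the form.\<close>

lemma positive_form_coercive:
  fixes a :: "'a::euclidean_space \<Rightarrow> 'a"
  assumes "linear a" "subspace V" and pos: "\<And>w. w \<in> V - {0} \<Longrightarrow> 0 < w \<bullet> a w"
  obtains c where "c > 0" "\<And>v. v \<in> V \<Longrightarrow> c * (norm v)\<^sup>2 \<le> v \<bullet> a v"
proof (cases "V \<inter> sphere 0 1 = {}")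
  case True
  have "v = 0" if "v \<in> V" for v
  proof (rule ccontr)
    assume "v \<noteq> 0"
    then have "(1 / norm v) *\<^sub>R v \<in> V \<inter> sphere 0 1"
      using that \<open>subspace V\<close> by (auto intro: subspace_scale)
    then show False using True by blast
  qed
  \<comment> \<open>On the trivial subspace both sides vanish and any positive constant
    serves.\<close>
  then show ?thesis using linear_0[OF \<open>linear a\<close>] by (intro that[of 1]) fastforce+
next
  case False
  have "continuous_on (V \<inter> sphere 0 1) (\<lambda>v. v \<bullet> a v)"
    using \<open>linear a\<close> by (intro continuous_intros linear_continuous_on) (simp add: linear_linear)
  moreover have "compact (V \<inter> sphere 0 1)"
    using \<open>subspace V\<close> by (simp add: closed_Int_compact closed_subspace)
  ultimately obtain x where x: "x \<in> V \<inter> sphere 0 1"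
    "\<And>y. y \<in> V \<inter> sphere 0 1 \<Longrightarrow> x \<bullet> a x \<le> y \<bullet> a y"
    using continuous_attains_inf False by metis
  show ?thesis
  proof (rule that[of "x \<bullet> a x"])
    have "x \<noteq> 0" using x(1) by auto
    then show "0 < x \<bullet> a x" using pos[of x] x(1) by simp
    show "x \<bullet> a x * (norm v)\<^sup>2 \<le> v \<bullet> a v" if "v \<in> V" for v
    proof (cases "v = 0")
      case True
      then show ?thesis using linear_0[OF \<open>linear a\<close>] by simp
    next
      case False
      then have "(1 / norm v) *\<^sub>R v \<in> V \<inter> sphere 0 1"
        using that \<open>subspace V\<close> by (auto intro: subspace_scale)
      from x(2)[OF this] show ?thesis
        using False \<open>linear a\<close> by (simp add: linear_scale field_simps power2_eq_square)
    qed
  qed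
qed

section \<open>Exponential rates and implicit linear recursions\<close>

lemma liminf_elog_ge_of_geometric:
  assumes "r > 0" "c > 0" and bound: "\<forall>\<^sub>F n in sequentially. c * r ^ n \<le> x n"
  shows "ereal (ln r) \<le> liminf (\<lambda>n. ereal (1 / real n) * elog (x n))"
proof -
  \<comment> \<open>For n > 0 this is the logarithm of \<open>c * r ^ n\<close> divided by n; the
    factor \<open>c\<close> disappears in the limit.\<close>
  have "(\<lambda>n. ln c / real n + ln r) \<longlonglongrightarrow> 0 + ln r"
    by (intro tendsto_add tendsto_const lim_const_over_n)
  then have "(\<lambda>n. ereal (ln c / real n + ln r)) \<longlonglongrightarrow> ereal (ln r)"
    by simp
  from lim_imp_Liminf[OF sequentially_bot this] have "ereal (ln r) = liminf (\<lambda>n. ereal (ln c / real n + ln r))"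
    by simp
  also have "\<dots> \<le> liminf (\<lambda>n. ereal (1 / real n) * elog (x n))"
  proof (rule Liminf_mono)
    show "\<forall>\<^sub>F n in sequentially. ereal (ln c / real n + ln r) \<le> ereal (1 / real n) * elog (x n)"
      using bound eventually_gt_at_top[of 0]
    proof eventually_elim
      case (elim n)
      have cr: "c * r ^ n > 0" using assms by simp
      then have "ln c + real n * ln r \<le> ln (x n)"
        using elim assms by (metis ln_mono ln_mult_pos ln_realpow zero_less_power)
      then have "(ln c + real n * ln r) / real n \<le> ln (x n) / real n"
        by (rule divide_right_mono) simp
      then have "ln c / real n + ln r \<le> 1 / real n * ln (x n)"
        using elim by (simp add: add_divide_distrib)
      moreover have "x n > 0" using cr elim by linarith
      ultimately show ?case by (simp add: elog_def)
    qed
  qed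
  finally show ?thesis .
qed

text \<open>Bounding the next term by the current one turns an error in
  \<open>norm (d n) + norm (d (Suc n))\<close> into one in \<open>norm (d n)\<close> alone. The
  residual is tested with \<open>d (Suc n)\<close>, where coercivity of \<open>a\<close>
  applies.\<close>

lemma implicit_linear_recursion_norm_bound:
  fixes a b :: "'a::euclidean_space \<Rightarrow> 'a" and d :: "nat \<Rightarrow> 'a"
  assumes a: "linear a" and b: "linear b" and V: "subspace V" and dV: "\<And>n. d n \<in> V"
    and pos: "\<And>w. w \<in> V - {0} \<Longrightarrow> 0 < w \<bullet> a w"
    and res: "\<And>\<epsilon>. \<epsilon> > 0 \<Longrightarrow> \<forall>\<^sub>F n in sequentially. \<forall>w\<in>V.
      \<bar>w \<bullet> (a (d (Suc n)) - b (d n))\<bar> \<le> \<epsilon> * norm w * (norm (d n) + norm (d (Suc n)))"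
  obtains C where "C > 0" "\<forall>\<^sub>F n in sequentially. norm (d (Suc n)) \<le> C * norm (d n)"
proof -
  obtain c where c: "c > 0" "\<And>v. v \<in> V \<Longrightarrow> c * (norm v)\<^sup>2 \<le> v \<bullet> a v"
    using positive_form_coercive[OF a V pos] by blast
  obtain K where K: "K > 0" "\<And>v. norm (b v) \<le> norm v * K"
    using bounded_linear.pos_bounded b linear_conv_bounded_linear by metis
  show ?thesis
  \<comment> \<open>With \<epsilon> = c / 2 the residual uses up half of the coercive term. What
    remains is \<open>c / 2 * y \<le> (K + c / 2) * x\<close>, which yields this constant.\<close>
  proof (rule that[of "2 * (K + c / 2) / c"])
    show "\<forall>\<^sub>F n in sequentially. norm (d (Suc n)) \<le> 2 * (K + c / 2) / c * norm (d n)"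
      using res[OF half_gt_zero[OF c(1)]]
    proof eventually_elim
      case (elim n)
      define x y where "x = norm (d n)" and "y = norm (d (Suc n))"
      have "d (Suc n) \<bullet> b (d n) \<le> y * (x * K)"
        unfolding x_def y_def using norm_cauchy_schwarz K(2) mult_left_mono norm_ge_zero order_trans
        by (metis (no_types))
      moreover have "d (Suc n) \<bullet> a (d (Suc n)) - d (Suc n) \<bullet> b (d n) \<le> c / 2 * y * (x + y)"
        using elim dV[of "Suc n"] unfolding x_def y_def inner_diff_right
        by (blast intro: order_trans[OF abs_ge_self])
      ultimately have "c * y\<^sup>2 \<le> y * (x * K) + c / 2 * y * (x + y)"
        using c(2)[OF dV, of "Suc n"] unfolding y_def by linarith
      moreover have "c * y\<^sup>2 - c / 2 * y * (x + y) - y * (x * K)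
          = y * (c / 2 * y) - y * ((K + c / 2) * x)"
        by (simp add: field_simps power2_eq_square)
      ultimately have "y * (c / 2 * y) \<le> y * ((K + c / 2) * x)" by linarith
      moreover have "y \<ge> 0" "x \<ge> 0" unfolding x_def y_def by auto
      ultimately have "c / 2 * y \<le> (K + c / 2) * x"
        using K(1) c(1) by (cases "y = 0") (auto simp: mult_le_cancel_left_pos)
      then show ?case unfolding x_def[symmetric] y_def[symmetric]
        using c(1) by (simp add: field_simps)
    qed
  qed (use K c in simp)
qed

text \<open>Once the bound is in force, a single zero makes all later terms zero, which
  \<open>nz\<close> excludes.\<close>

lemma eventually_nonzero_of_norm_bound:
  fixes d :: "nat \<Rightarrow> 'a::real_normed_vector"
  assumes bound: "\<forall>\<^sub>F n in sequentially. norm (d (Suc n)) \<le> C * norm (d n)"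
    and nz: "\<not> (\<forall>\<^sub>F n in sequentially. d n = 0)"
  shows "\<forall>\<^sub>F n in sequentially. d n \<noteq> 0"
proof -
  obtain N where N: "\<And>n. n \<ge> N \<Longrightarrow> norm (d (Suc n)) \<le> C * norm (d n)"
    using bound unfolding eventually_sequentially by blast
  have "d n \<noteq> 0" if "n \<ge> N" for n
  proof
    assume "d n = 0"
    have "d m = 0" if "m \<ge> n" for m
      using that
    proof (induction m rule: dec_induct)
      case (step m)
      then show ?case using N[of m] \<open>n \<ge> N\<close> by simp
    qed (fact \<open>d n = 0\<close>)
    then show False using nz unfolding eventually_sequentially by blast
  qed
  then show ?thesis unfolding eventually_sequentially by blast
qed

text \<open>The test vector is \<open>d n\<close>, because \<open>ratio\<close> controls only the
  quadratic form \<open>v \<bullet> b v\<close>. This bounds the \<open>a\<close>-product of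
  \<open>d n\<close> and \<open>d (Suc n)\<close> from below, and Cauchy-Schwarz passes to the
  \<open>a\<close>-norms. The gap \<open>r - s\<close> pays for the residual.\<close>

lemma implicit_linear_recursion_lower_step:
  fixes a b :: "'a::euclidean_space \<Rightarrow> 'a" and d :: "nat \<Rightarrow> 'a"
  assumes a: "linear a" and b: "linear b" and V: "subspace V" and dV: "\<And>n. d n \<in> V"
    and pos: "\<And>w. w \<in> V - {0} \<Longrightarrow> 0 < w \<bullet> a w"
    and sym: "\<And>u v. u \<bullet> a v = v \<bullet> a u"
    and res: "\<And>\<epsilon>. \<epsilon> > 0 \<Longrightarrow> \<forall>\<^sub>F n in sequentially. \<forall>w\<in>V.
      \<bar>w \<bullet> (a (d (Suc n)) - b (d n))\<bar> \<le> \<epsilon> * norm w * (norm (d n) + norm (d (Suc n)))"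
    and nz: "\<not> (\<forall>\<^sub>F n in sequentially. d n = 0)"
    and ratio: "\<And>v. v \<in> V \<Longrightarrow> r * (v \<bullet> a v) \<le> \<bar>v \<bullet> b v\<bar>"
    and s: "s < r"
  shows "\<forall>\<^sub>F n in sequentially. d n \<noteq> 0 \<and>
    s * sqrt (d n \<bullet> a (d n)) \<le> sqrt (d (Suc n) \<bullet> a (d (Suc n)))"
proof -
  obtain c where c: "c > 0" "\<And>v. v \<in> V \<Longrightarrow> c * (norm v)\<^sup>2 \<le> v \<bullet> a v"
    using positive_form_coercive[OF a V pos] by blast
  obtain C where C: "C > 0" "\<forall>\<^sub>F n in sequentially. norm (d (Suc n)) \<le> C * norm (d n)"
    using implicit_linear_recursion_norm_bound[OF a b V dV pos res] by blast
  \<comment> \<open>Chosen so that, after the norm bound with \<open>C\<close> and coercivity with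
    \<open>c\<close>, the residual is at most \<open>(r - s) * (x \<bullet> a x)\<close>.\<close>
  define \<epsilon> where "\<epsilon> = (r - s) * c / (1 + C)"
  have "\<epsilon> > 0" unfolding \<epsilon>_def using s c C by simp
  show ?thesis
    using eventually_nonzero_of_norm_bound[OF C(2) nz] C(2) res[OF \<open>\<epsilon> > 0\<close>]
  proof eventually_elim
    case (elim n)
    define x y where "x = d n" and "y = d (Suc n)"
    have xV: "x \<in> V" "y \<in> V" and "x \<noteq> 0" unfolding x_def y_def using dV elim by auto
    have xx: "0 < x \<bullet> a x" using pos xV \<open>x \<noteq> 0\<close> by simp
    have "\<bar>x \<bullet> a y - x \<bullet> b x\<bar> \<le> \<epsilon> * norm x * (norm x + norm y)"
      using elim xV(1) unfolding x_def y_def by (force simp: inner_diff_right)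
    also have "\<dots> \<le> \<epsilon> * norm x * (norm x + C * norm x)"
      using elim \<open>\<epsilon> > 0\<close> unfolding x_def y_def by (intro mult_left_mono) auto
    also have "\<dots> = (r - s) * (c * (norm x)\<^sup>2)"
      unfolding \<epsilon>_def using C(1) by (simp add: field_simps power2_eq_square)
    also have "\<dots> \<le> (r - s) * (x \<bullet> a x)"
      using c(2)[OF xV(1)] s by (intro mult_left_mono) auto
    finally have "s * (x \<bullet> a x) \<le> \<bar>x \<bullet> a y\<bar>"
      using ratio[OF xV(1)] unfolding left_diff_distrib by linarith
    also have "\<dots> \<le> sqrt ((x \<bullet> a x) * (y \<bullet> a y))"
      using positive_form_Cauchy_Schwarz[OF a V xV pos sym] by (simp add: real_le_rsqrt)
    also have "\<dots> = sqrt (x \<bullet> a x) * sqrt (y \<bullet> a y)"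
      by (simp add: real_sqrt_mult)
    finally have "sqrt (x \<bullet> a x) * (s * sqrt (x \<bullet> a x)) \<le> sqrt (x \<bullet> a x) * sqrt (y \<bullet> a y)"
      using xx by (simp add: mult.left_commute)
    then show ?case
      using xx elim(1) unfolding x_def y_def by (simp add: mult_le_cancel_left_pos)
  qed
qed

lemma geometric_lower_bound:
  fixes x :: "nat \<Rightarrow> real"
  assumes "s > 0" and step: "\<forall>\<^sub>F n in sequentially. 0 < x n \<and> s * x n \<le> x (Suc n)"
  obtains c where "c > 0" "\<forall>\<^sub>F n in sequentially. c * s ^ n \<le> x n"
proof -
  obtain N where N: "\<And>n. n \<ge> N \<Longrightarrow> 0 < x n \<and> s * x n \<le> x (Suc n)"
    using step unfolding eventually_sequentially by blast
  \<comment> \<open>The constant makes the bound an equality at \<open>N\<close>, where the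
    induction starts.\<close>
  have "x N / s ^ N * s ^ n \<le> x n" if "n \<ge> N" for n
    using that
  proof (induction n rule: dec_induct)
    case (step n)
    then have "s * (x N / s ^ N * s ^ n) \<le> s * x n"
      using \<open>s > 0\<close> by (intro mult_left_mono) auto
    then show ?case using N[OF step.hyps(1)] by (simp add: mult.left_commute)
  qed (use \<open>s > 0\<close> in simp)
  then show ?thesis
    using \<open>s > 0\<close> N[of N] by (intro that[of "x N / s ^ N"]) (auto simp: eventually_sequentially)
qed

text \<open>Every positive \<open>s < r\<close> is eventually a lower growth factor of the
  \<open>a\<close>-norm. That norm is at most a constant times the Euclidean one, constants do not
  affect the exponential rate, and \<open>s\<close> may approach \<open>r\<close>.\<close>

lemma implicit_linear_recursion_liminf:
  fixes a b :: "'a::euclidean_space \<Rightarrow> 'a" and d :: "nat \<Rightarrow> 'a"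
  assumes a: "linear a" and b: "linear b" and V: "subspace V" and dV: "\<And>n. d n \<in> V"
    and pos: "\<And>w. w \<in> V - {0} \<Longrightarrow> 0 < w \<bullet> a w"
    and sym: "\<And>u v. u \<bullet> a v = v \<bullet> a u"
    and res: "\<And>\<epsilon>. \<epsilon> > 0 \<Longrightarrow> \<forall>\<^sub>F n in sequentially. \<forall>w\<in>V.
      \<bar>w \<bullet> (a (d (Suc n)) - b (d n))\<bar> \<le> \<epsilon> * norm w * (norm (d n) + norm (d (Suc n)))"
    and nz: "\<not> (\<forall>\<^sub>F n in sequentially. d n = 0)"
    and ratio: "\<And>v. v \<in> V \<Longrightarrow> r * (v \<bullet> a v) \<le> \<bar>v \<bullet> b v\<bar>"
  shows "elog r \<le> liminf (\<lambda>n. ereal (1 / real n) * elog (norm (d n)))"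
proof (cases "r > 0")
  \<comment> \<open>Here \<open>elog r\<close> is minus infinity, so the inequality is
    trivial.\<close>
  case False
  then show ?thesis by (simp add: elog_def)
next
  case True
  obtain K where K: "K > 0" "\<And>v. norm (a v) \<le> norm v * K"
    using bounded_linear.pos_bounded a linear_conv_bounded_linear by metis
  have upper: "sqrt (v \<bullet> a v) \<le> norm v * sqrt K" for v
  proof -
    have "v \<bullet> a v \<le> norm v * (norm v * K)"
      using norm_cauchy_schwarz K(2) mult_left_mono norm_ge_zero order_trans by (metis (no_types))
    then have "sqrt (v \<bullet> a v) \<le> sqrt ((norm v)\<^sup>2 * K)"
      by (simp add: power2_eq_square mult.assoc)
    then show ?thesis by (simp add: real_sqrt_mult)
  qed
  have "ereal (ln r) \<le> liminf (\<lambda>n. ereal (1 / real n) * elog (norm (d n))) + ereal e"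
    if "e > 0" for e
  proof -
    \<comment> \<open>Scaling the ratio by \<open>exp (- e)\<close> lowers its logarithm by exactly
      \<open>e\<close>.\<close>
    define s where "s = r * exp (- e)"
    have s: "s > 0" "s < r" using True that by (simp_all add: s_def)
    have "\<forall>\<^sub>F n in sequentially. 0 < sqrt (d n \<bullet> a (d n)) \<and>
        s * sqrt (d n \<bullet> a (d n)) \<le> sqrt (d (Suc n) \<bullet> a (d (Suc n)))"
      using implicit_linear_recursion_lower_step[OF a b V dV pos sym res nz ratio s(2), simplified]
      by (rule eventually_mono) (use pos dV in auto)
    then obtain c where c: "c > 0" "\<forall>\<^sub>F n in sequentially. c * s ^ n \<le> sqrt (d n \<bullet> a (d n))"
      by (rule geometric_lower_bound[OF s(1)])
    have "\<forall>\<^sub>F n in sequentially. c / sqrt K * s ^ n \<le> norm (d n)"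
      using c(2)
    proof eventually_elim
      case (elim n)
      then have "c * s ^ n \<le> norm (d n) * sqrt K" using upper[of "d n"] by linarith
      then show ?case using K(1) by (simp add: field_simps)
    qed
    then have "ereal (ln s) \<le> liminf (\<lambda>n. ereal (1 / real n) * elog (norm (d n)))"
      using liminf_elog_ge_of_geometric[OF s(1), of "c / sqrt K"] c(1) K(1) by simp
    moreover have "ln s = ln r - e" unfolding s_def using True by (simp add: ln_mult_pos)
    ultimately have "ereal (ln r) - ereal e \<le> liminf (\<lambda>n. ereal (1 / real n) * elog (norm (d n)))"
      by simp
    then show ?thesis by (simp only: ereal_minus_le_iff abs_ereal.simps) (simp add: add.commute)
  qed
  then show ?thesis
    using True by (auto simp: elog_def intro: ereal_le_epsilon2)
qed

section \<open>First-order conditions at constrained minimisers, and partial derivatives\<close>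

lemma affine_hull_add_diff_span:
  assumes "v \<in> diff_span S" "y \<in> affine hull S"
  shows "y + v \<in> affine hull S"
proof -
  \<comment> \<open>The quantifier over \<open>y\<close> belongs to the induction, since the
    induction hypothesis is applied to an already translated point.\<close>
  have "\<forall>y \<in> affine hull S. y + v \<in> affine hull S"
    using assms(1) unfolding diff_span_def
  proof (induction rule: span_induct_alt)
    case (step c x z)
    then obtain p q where pq: "x = p - q" "p \<in> S" "q \<in> S" by auto
    have "y + c *\<^sub>R x \<in> affine hull S" if "y \<in> affine hull S" for y
      unfolding pq using that pq(2,3)
      by (intro mem_affine_3_minus) (auto simp: hull_inc)
    then show ?case using step.IH by (metis add.assoc)
  qed simp
  then show ?thesis using assms(2) by blast
qed

text \<open>The definite description in \<open>grad2\<close> denotes because a gradient is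
  determined by its inner products with all vectors.\<close>

lemma grad2_GDERIV:
  assumes "GDERIV (Q x) y :> D"
  shows "GDERIV (Q x) y :> grad2 Q x y"
proof -
  have "E = D" if "GDERIV (Q x) y :> E" for E
  proof -
    have "(\<lambda>h. h \<bullet> E) = (\<lambda>h. h \<bullet> D)"
      using that assms unfolding gderiv_def by (rule has_derivative_unique)
    then show ?thesis by (metis vector_eq_ldot)
  qed
  then show ?thesis unfolding grad2_def using assms by (metis theI)
qed

text \<open>Inside the ball, a point of \<Theta> can be moved slightly in both senses along
  \<open>v\<close> without leaving \<Theta>, so the constrained minimiser is a two-sided local
  minimum on that line.\<close>

lemma grad2_argmin_orthogonal:
  assumes "GDERIV (Q x) y :> D" and y: "y \<in> argmin_map Q \<Theta> x"
    and ball: "ball a e \<inter> affine hull \<Theta> \<subseteq> \<Theta>" "dist a y < e" and v: "v \<in> diff_span \<Theta>"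
  shows "grad2 Q x y \<bullet> v = 0"
proof -
  have y\<Theta>: "y \<in> \<Theta>" and min: "\<And>z. z \<in> \<Theta> \<Longrightarrow> Q x y \<le> Q x z"
    using y unfolding argmin_map_def by (auto simp: is_arg_min_linorder)
  \<comment> \<open>A move by less than \<delta> along \<open>v\<close> is shorter than
    \<open>e - dist a y\<close>, the room left in the ball.\<close>
  define \<delta> where "\<delta> = (e - dist a y) / (norm v + 1)"
  have "norm v + 1 > 0" by (simp add: add_nonneg_pos)
  show ?thesis
  proof (rule GDERIV_local_min_orthogonal[OF grad2_GDERIV[where Q = Q and x = x, OF assms(1)]])
    show "\<delta> > 0" unfolding \<delta>_def using ball(2) \<open>norm v + 1 > 0\<close> by simp
    fix t :: real assume "\<bar>t\<bar> < \<delta>"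
    then have "\<bar>t\<bar> * (norm v + 1) < e - dist a y"
      unfolding \<delta>_def using \<open>norm v + 1 > 0\<close> by (simp add: pos_less_divide_eq)
    then have "dist y (y + t *\<^sub>R v) < e - dist a y"
      by (simp add: dist_norm algebra_simps)
    then have "y + t *\<^sub>R v \<in> ball a e"
      using dist_triangle[of a "y + t *\<^sub>R v" y] by simp
    moreover have "y + t *\<^sub>R v \<in> affine hull \<Theta>"
      using v y\<Theta>
      by (intro affine_hull_add_diff_span) (auto simp: hull_inc diff_span_def intro: span_scale)
    ultimately show "Q x y \<le> Q x (y + t *\<^sub>R v)" using ball(1) min by blast
  qed
qed

text \<open>Composition with the two slice embeddings makes the slices differentiable. Only then
  does \<open>jacobian\<close> represent their derivatives, and uniqueness identifies them with
  \<open>D\<close> on each factor.\<close>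

lemma grad2_partial_derivatives:
  fixes Q :: "real^'q \<Rightarrow> real^'q \<Rightarrow> real"
  assumes D: "((\<lambda>(x, y). grad2 Q x y) has_derivative D) (at (x, y))"
  shows "((\<lambda>y. grad2 Q x y) has_derivative (\<lambda>k. hess22 Q x y *v k)) (at y)"
    and "D (h, k) = hess12 Q x y *v h + hess22 Q x y *v k"
proof -
  interpret D: bounded_linear D using D by (rule has_derivative_bounded_linear)
  have "((\<lambda>y. (x, y)) has_derivative (\<lambda>k. (0, k))) (at y)"
    by (auto intro!: derivative_eq_intros)
  from has_derivative_compose[OF this, of "\<lambda>(x, y). grad2 Q x y"] D
  have 2: "((\<lambda>y. grad2 Q x y) has_derivative (\<lambda>k. D (0, k))) (at y)" by simp
  have "((\<lambda>x. (x, y)) has_derivative (\<lambda>h. (h, 0))) (at x)"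
    by (auto intro!: derivative_eq_intros)
  from has_derivative_compose[OF this, of "\<lambda>(x, y). grad2 Q x y"] D
  have 1: "((\<lambda>x. grad2 Q x y) has_derivative (\<lambda>h. D (h, 0))) (at x)" by simp
  show 22: "((\<lambda>y. grad2 Q x y) has_derivative (\<lambda>k. hess22 Q x y *v k)) (at y)"
    unfolding hess22_def using 2 jacobian_works differentiableI by blast
  have 12: "((\<lambda>x. grad2 Q x y) has_derivative (\<lambda>h. hess12 Q x y *v h)) (at x)"
    unfolding hess12_def using 1 jacobian_works differentiableI by blast
  have "D (h, k) = D (h, 0) + D (0, k)" by (simp flip: D.add)
  also have "D (h, 0) = hess12 Q x y *v h"
    using has_derivative_unique[OF 1 12] by meson
  also have "D (0, k) = hess22 Q x y *v k"
    using has_derivative_unique[OF 2 22] by meson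
  finally show "D (h, k) = hess12 Q x y *v h + hess22 Q x y *v k" .
qed

section \<open>Linearised stationarity along the iterates\<close>

theorem theorem2:
  fixes Q :: "real^'q \<Rightarrow> real^'q \<Rightarrow> real"
    and \<Theta> :: "(real^'q) set"
    and \<theta> :: "nat \<Rightarrow> real^'q"
    and \<theta>s :: "real^'q"
    and A B :: "real^'q^'q"
    and V :: "(real^'q) set"
  defines "A \<equiv> hess22 Q \<theta>s \<theta>s"
    and "B \<equiv> - hess12 Q \<theta>s \<theta>s"
    and "V \<equiv> diff_span \<Theta>"
  assumes argmin_nonempty: "\<And>x. x \<in> \<Theta> \<Longrightarrow> argmin_map Q \<Theta> x \<noteq> {}"
    and seq_in: "\<And>n. \<theta> n \<in> \<Theta>"
    and seq_step: "\<And>n. \<theta> (Suc n) \<in> argmin_map Q \<Theta> (\<theta> n)"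
    and star_in: "\<theta>s \<in> \<Theta>"
    and conv: "convex \<Theta>"
    and lim: "\<theta> \<longlonglongrightarrow> \<theta>s"
    and smooth: "\<exists>U. open U \<and> (\<theta>s, \<theta>s) \<in> U
        \<and> continuous_on U (\<lambda>(x, y). Q x y)
        \<and> (\<forall>(x, y)\<in>U. \<exists>D. GDERIV (Q x) y :> D)
        \<and> C1_on (\<lambda>(x, y). grad2 Q x y) U"
    and B_sym: "transpose B = B"
    and A_dominates: "\<And>v. v \<in> V - {0} \<Longrightarrow> v \<bullet> (A *v v) > \<bar>v \<bullet> (B *v v)\<bar>"
    and star_ri: "\<theta>s \<in> rel_interior \<Theta>"
    and not_eventually: "\<not> (\<forall>\<^sub>F n in sequentially. \<theta> n = \<theta>s)"
  shows "rho_check A B V \<in> {0..<1} \<and>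
    elog (rho_check A B V)
      \<le> liminf (\<lambda>n. ereal (1 / real n) * elog (norm (\<theta> n - \<theta>s)))"
proof -
  let ?G = "\<lambda>(x, y). grad2 Q x y"
  define d where "d n = \<theta> n - \<theta>s" for n
  obtain U where U: "open U" "(\<theta>s, \<theta>s) \<in> U"
    "\<forall>(x, y)\<in>U. \<exists>D. GDERIV (Q x) y :> D" "C1_on ?G U"
    using smooth by (elim exE conjE) (rule that)
  have grad: "GDERIV (Q x) y :> grad2 Q x y" if "(x, y) \<in> U" for x y
    using bspec[OF U(3) that] by (auto intro: grad2_GDERIV)
  obtain D where D: "(?G has_derivative D) (at (\<theta>s, \<theta>s))"
    using U(2,4) unfolding C1_on_def by blast
  have D_eq: "D (h, k) = A *v k - B *v h" for h k
    using grad2_partial_derivatives(2)[OF D]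
    using matrix_vector_mult_diff_rdistrib[of 0 "hess12 Q \<theta>s \<theta>s" h]
    by (simp add: A_def B_def)
  have V: "subspace V" unfolding V_def diff_span_def by simp
  have dV: "d n \<in> V" for n
    unfolding d_def V_def diff_span_def using seq_in star_in by (intro span_base) blast
  have pos: "0 < v \<bullet> (A *v v)" if "v \<in> V - {0}" for v
    using A_dominates[OF that] by linarith
  \<comment> \<open>Near \<theta>s the function \<open>Q \<theta>s\<close> has gradient
    \<open>grad2 Q \<theta>s\<close>, whose derivative at \<theta>s is \<open>A\<close>, so
    \<open>A\<close> is a genuine second derivative.\<close>
  have A_sym: "u \<bullet> (A *v v) = v \<bullet> (A *v u)" for u v
  proof (rule gradient_derivative_symmetric)
    show "((\<lambda>y. grad2 Q \<theta>s y) has_derivative (\<lambda>k. A *v k)) (at \<theta>s)"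
      unfolding A_def by (rule grad2_partial_derivatives(1)[OF D])
    have "((\<lambda>y. (\<theta>s, y)) \<longlongrightarrow> (\<theta>s, \<theta>s)) (nhds \<theta>s)"
      by (intro tendsto_intros) (simp add: filterlim_ident)
    then have "\<forall>\<^sub>F y in nhds \<theta>s. (\<theta>s, y) \<in> U"
      using U(1,2) by (rule topological_tendstoD)
    then show "\<forall>\<^sub>F y in nhds \<theta>s. GDERIV (Q \<theta>s) y :> grad2 Q \<theta>s y"
      by eventually_elim (rule grad)
  qed
  have lim2: "(\<lambda>n. (\<theta> n, \<theta> (Suc n))) \<longlonglongrightarrow> (\<theta>s, \<theta>s)"
    using lim by (intro tendsto_Pair) (auto simp: filterlim_sequentially_Suc)
  obtain e where e: "e > 0" "ball \<theta>s e \<inter> affine hull \<Theta> \<subseteq> \<Theta>"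
    using star_ri unfolding mem_rel_interior_ball by blast
  \<comment> \<open>The minimiser produced from \<open>\<theta> n\<close> is
    \<open>\<theta> (Suc n)\<close>, so it is the shifted term that must lie in the ball.\<close>
  have "\<forall>\<^sub>F n in sequentially. dist \<theta>s (\<theta> (Suc n)) < e"
    using tendstoD[OF LIMSEQ_Suc[OF lim] e(1)] by (simp add: dist_commute)
  moreover have "\<forall>\<^sub>F n in sequentially. (\<theta> n, \<theta> (Suc n)) \<in> U"
    using topological_tendstoD[OF lim2 U(1,2)] .
  ultimately have orth: "\<forall>\<^sub>F n in sequentially. \<forall>v\<in>V. v \<bullet> grad2 Q (\<theta> n) (\<theta> (Suc n)) = 0"
  proof eventually_elim
    case (elim n)
    show ?case
      using grad2_argmin_orthogonal[OF grad[OF elim(2)] seq_step e(2) elim(1)] unfolding V_def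
      by (simp add: inner_commute)
  qed
  \<comment> \<open>Stationarity at \<theta>s is inherited from the iterates through continuity of
    the gradient at the limit pair.\<close>
  have orth_lim: "v \<bullet> grad2 Q \<theta>s \<theta>s = 0" if "v \<in> V" for v
  proof -
    have "isCont ?G (\<theta>s, \<theta>s)" using D by (rule has_derivative_continuous)
    from isCont_tendsto_compose[OF this lim2]
    have "(\<lambda>n. v \<bullet> grad2 Q (\<theta> n) (\<theta> (Suc n))) \<longlonglongrightarrow> v \<bullet> grad2 Q \<theta>s \<theta>s"
      by (intro tendsto_intros) simp
    moreover have "(\<lambda>n. v \<bullet> grad2 Q (\<theta> n) (\<theta> (Suc n))) \<longlonglongrightarrow> 0"
      by (rule tendsto_eventually, use orth in eventually_elim) (use that in blast)
    ultimately show ?thesis by (rule LIMSEQ_unique)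
  qed
  have res: "\<forall>\<^sub>F n in sequentially. \<forall>w\<in>V. \<bar>w \<bullet> (A *v d (Suc n) - B *v d n)\<bar>
      \<le> \<epsilon> * norm w * (norm (d n) + norm (d (Suc n)))" if "\<epsilon> > 0" for \<epsilon>
  proof -
    obtain \<delta> where \<delta>: "\<delta> > 0" "\<And>p. norm (p - (\<theta>s, \<theta>s)) < \<delta> \<Longrightarrow>
      norm (?G p - ?G (\<theta>s, \<theta>s) - D (p - (\<theta>s, \<theta>s))) \<le> \<epsilon> * norm (p - (\<theta>s, \<theta>s))"
      using D \<open>\<epsilon> > 0\<close> unfolding has_derivative_at_alt by blast
    show ?thesis
      using tendstoD[OF lim2 \<delta>(1)] orth
    proof eventually_elim
      case (elim n)
      \<comment> \<open>Both gradients are orthogonal to \<open>V\<close>, hence so is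
        \<open>g\<close>. Against \<open>w\<close> in \<open>V\<close>, the linear part therefore
        equals minus the error of the first-order expansion.\<close>
      define g where "g = grad2 Q (\<theta> n) (\<theta> (Suc n)) - grad2 Q \<theta>s \<theta>s"
      have "norm (g - (A *v d (Suc n) - B *v d n)) \<le> \<epsilon> * norm (d n, d (Suc n))"
        using \<delta>(2)[of "(\<theta> n, \<theta> (Suc n))"] elim(1) D_eq[of "d n" "d (Suc n)"]
        by (simp add: g_def d_def dist_norm)
      also have "\<dots> \<le> \<epsilon> * (norm (d n) + norm (d (Suc n)))"
        using \<open>\<epsilon> > 0\<close> by (intro mult_left_mono norm_Pair_le) auto
      finally have g: "norm (g - (A *v d (Suc n) - B *v d n))
        \<le> \<epsilon> * (norm (d n) + norm (d (Suc n)))" .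
      show ?case
      proof
        fix w assume "w \<in> V"
        then have "w \<bullet> g = 0" using elim(2) orth_lim by (simp add: g_def inner_diff_right)
        then have "\<bar>w \<bullet> (A *v d (Suc n) - B *v d n)\<bar> = \<bar>w \<bullet> (g - (A *v d (Suc n) - B *v d n))\<bar>"
          by (simp add: inner_diff_right)
        also have "\<dots> \<le> norm w * (\<epsilon> * (norm (d n) + norm (d (Suc n))))"
          using Cauchy_Schwarz_ineq2 g by (meson mult_left_mono norm_ge_zero order_trans)
        finally show "\<bar>w \<bullet> (A *v d (Suc n) - B *v d n)\<bar>
          \<le> \<epsilon> * norm w * (norm (d n) + norm (d (Suc n)))" by (simp add: mult_ac)
      qed
    qed
  qed
  have nz: "\<not> (\<forall>\<^sub>F n in sequentially. d n = 0)"
    using not_eventually by (simp add: d_def)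
  \<comment> \<open>A nonzero error vector shows that \<open>V\<close> is nontrivial, so the infimum
    runs over a nonempty set.\<close>
  obtain n where "d n \<noteq> 0" using nz by (auto simp: eventually_sequentially)
  then have ne: "d n \<in> V - {0}" using dV by simp
  have quot_nonneg: "0 \<le> \<bar>v \<bullet> (B *v v)\<bar> / (v \<bullet> (A *v v))" if "v \<in> V - {0}" for v
    using pos[OF that] by simp
  have bdd: "bdd_below ((\<lambda>v. \<bar>v \<bullet> (B *v v)\<bar> / (v \<bullet> (A *v v))) ` (V - {0}))"
    using quot_nonneg by (rule bdd_belowI2)
  have le: "rho_check A B V \<le> \<bar>v \<bullet> (B *v v)\<bar> / (v \<bullet> (A *v v))" if "v \<in> V - {0}" for v
    unfolding rho_check_def using bdd that by (rule cINF_lower)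
  have "0 \<le> rho_check A B V"
    unfolding rho_check_def using ne quot_nonneg by (intro cINF_greatest) auto
  \<comment> \<open>Any single quotient bounds the infimum from above, so one quotient below 1 gives
    the strict inequality.\<close>
  moreover have "\<bar>d n \<bullet> (B *v d n)\<bar> / (d n \<bullet> (A *v d n)) < 1"
    using A_dominates[OF ne] pos[OF ne] by simp
  then have "rho_check A B V < 1" using le[OF ne] by linarith
  moreover have "rho_check A B V * (v \<bullet> (A *v v)) \<le> \<bar>v \<bullet> (B *v v)\<bar>" if "v \<in> V" for v
    using le[of v] pos[of v] that by (cases "v = 0") (auto simp: pos_le_divide_eq)
  then have "elog (rho_check A B V) \<le> liminf (\<lambda>n. ereal (1 / real n) * elog (norm (d n)))"
    by (intro implicit_linear_recursion_liminf[of "\<lambda>v. A *v v" "\<lambda>v. B *v v" V])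
      (use V dV pos A_sym res nz in auto)
  ultimately show ?thesis by (simp add: d_def)
qed

end
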